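(* A countable group $\Gamma$ admits a faithful almost free action by orientation-preserving homeomorphisms of the real line if and only if $\Gamma$ is bi-orderable.
   Context: An action of a group $\Gamma$ by orientation-preserving homeomorphisms of $\mathbb{R}$ is almost free if for every $g \in \Gamma$ one has either $g(x) \geq x$ for all $x \in \mathbb{R}$ or $g(x) \leq x$ for all $x \in \mathbb{R}$. A group is bi-orderable if it admits a total order that is simultaneously left-invariant and right-invariant. *)

theory Defs
  imports "HOL-Analysis.Analysis" "HOL-Algebra.Group_Action"
begin

text \<open>
  A homeomorphism of the line is orientation-preserving iff it is increasing.
\<close>

definition orientation_preserving_homeo :: "(real \<Rightarrow> real) \<Rightarrow> bool" where
  "orientation_preserving_homeo f \<longleftrightarrow>
     (\<exists>f'. homeomorphism UNIV UNIV f f') \<and> strict_mono f"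

text \<open>
  Both locales \<open>group_action\<close> and \<open>faithful_action\<close> concern actions by arbitrary bijections;
  the topological condition on the action is imposed here.
\<close>

definition homeo_action_on_line ::
    "('a, 'b) monoid_scheme \<Rightarrow> ('a \<Rightarrow> real \<Rightarrow> real) \<Rightarrow> bool" where
  "homeo_action_on_line G \<phi> \<longleftrightarrow>
     group_action G UNIV \<phi> \<and> (\<forall>g \<in> carrier G. orientation_preserving_homeo (\<phi> g))"

definition almost_free_action ::
    "('a, 'b) monoid_scheme \<Rightarrow> ('a \<Rightarrow> real \<Rightarrow> real) \<Rightarrow> bool" where
  "almost_free_action G \<phi> \<longleftrightarrow>
     homeo_action_on_line G \<phi> \<and>
     (\<forall>g \<in> carrier G. (\<forall>x. \<phi> g x \<ge> x) \<or> (\<forall>x. \<phi> g x \<le> x))"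

definition left_invariant_rel :: "('a, 'b) monoid_scheme \<Rightarrow> 'a rel \<Rightarrow> bool" where
  "left_invariant_rel G r \<longleftrightarrow>
     (\<forall>a \<in> carrier G. \<forall>b \<in> carrier G. \<forall>c \<in> carrier G.
        (a, b) \<in> r \<longrightarrow> (c \<otimes>\<^bsub>G\<^esub> a, c \<otimes>\<^bsub>G\<^esub> b) \<in> r)"

definition right_invariant_rel :: "('a, 'b) monoid_scheme \<Rightarrow> 'a rel \<Rightarrow> bool" where
  "right_invariant_rel G r \<longleftrightarrow>
     (\<forall>a \<in> carrier G. \<forall>b \<in> carrier G. \<forall>c \<in> carrier G.
        (a, b) \<in> r \<longrightarrow> (a \<otimes>\<^bsub>G\<^esub> c, b \<otimes>\<^bsub>G\<^esub> c) \<in> r)"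

definition bi_orderable :: "('a, 'b) monoid_scheme \<Rightarrow> bool" where
  "bi_orderable G \<longleftrightarrow>
     (\<exists>r. linear_order_on (carrier G) r \<and> left_invariant_rel G r \<and> right_invariant_rel G r)"

end

theory Submission
  imports Defs
begin

text \<open>
  An almost free action orders the group by comparing the homeomorphisms pointwise: almost freeness
  applied to \<open>a\<^sup>-\<^sup>1 b\<close> says precisely that \<open>a\<close> and \<open>b\<close> are comparable.

  Conversely, choose summable positive weights on a countable bi-ordered group and lay out, in the
  order of the group, intervals with these weights as lengths. They fill an interval up to a set of
  measure zero, so after a change of coordinates the lexicographically ordered set
  \<open>\<Gamma> \<times> (0,1)\<close> is embedded densely in the line. Left multiplication on the first factor
  is increasing by left invariance, hence extends uniquely to the line, and it moves every point in
  the same direction by right invariance.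
\<close>

section \<open>Extending monotone maps from a dense set\<close>

text \<open>If the values at \<open>r\<close> differed, some common value
  \<open>f (e x) = g (e x)\<close> would lie strictly between them. But monotonicity puts it below
  both when \<open>e x <= r\<close> and above both when \<open>r <= e x\<close>.\<close>

lemma mono_eq_if_eq_on_dense_image:
  fixes f g :: "real \<Rightarrow> real"
  assumes "mono f" and "mono g"
    and eq: "\<And>x. x \<in> X \<Longrightarrow> f (e x) = g (e x)"
    and dense: "\<And>a b. a < b \<Longrightarrow> \<exists>x\<in>X. a < f (e x) \<and> f (e x) < b"
  shows "f = g"
proof
  fix r
  have le: "e x \<le> r \<Longrightarrow> f (e x) \<le> f r \<and> g (e x) \<le> g r"
    and ge: "r \<le> e x \<Longrightarrow> f r \<le> f (e x) \<and> g r \<le> g (e x)" for x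
    using assms(1,2) by (auto dest: monoD)
  show "f r = g r"
  proof (rule ccontr)
    assume "f r \<noteq> g r"
    then have "min (f r) (g r) < max (f r) (g r)"
      by auto
    from dense[OF this] obtain x where "x \<in> X" "min (f r) (g r) < f (e x)"
      "f (e x) < max (f r) (g r)"
      by blast
    with eq[of x] le[of x] ge[of x] show False
      by (cases "e x \<le> r") auto
  qed
qed

definition monotone_extension :: "'x set \<Rightarrow> ('x \<Rightarrow> real) \<Rightarrow> ('x \<Rightarrow> 'x) \<Rightarrow> real \<Rightarrow> real" where
  "monotone_extension X e T r = (SUP x\<in>{x\<in>X. e x \<le> r}. e (T x))"

text \<open>\<open>T_mono\<close> in both directions gives equal images to points with equal
  \<open>e\<close>. Hence the action descends to the dense image of \<open>X\<close> although
  \<open>e\<close> may fail to be injective.\<close>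

locale dense_action = group G for G :: "('a, 'b) monoid_scheme" (structure) +
  fixes X :: "'x set" and e :: "'x \<Rightarrow> real" and T :: "'a \<Rightarrow> 'x \<Rightarrow> 'x"
  assumes dense: "a < b \<Longrightarrow> \<exists>x\<in>X. a < e x \<and> e x < b"
    and T_closed: "g \<in> carrier G \<Longrightarrow> x \<in> X \<Longrightarrow> T g x \<in> X"
    and T_one: "x \<in> X \<Longrightarrow> T \<one> x = x"
    and T_mult: "g \<in> carrier G \<Longrightarrow> h \<in> carrier G \<Longrightarrow> x \<in> X \<Longrightarrow> T (g \<otimes> h) x = T g (T h x)"
    and T_mono: "g \<in> carrier G \<Longrightarrow> x \<in> X \<Longrightarrow> y \<in> X \<Longrightarrow> e x \<le> e y \<Longrightarrow> e (T g x) \<le> e (T g y)"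
begin

abbreviation ext :: "'a \<Rightarrow> real \<Rightarrow> real" where
  "ext g \<equiv> monotone_extension X e (T g)"

lemma extension_nonempty: "{x\<in>X. e x \<le> r} \<noteq> {}"
  using dense[of "r - 1" r] by force

lemma extension_bdd_above:
  assumes "g \<in> carrier G"
  shows "bdd_above ((\<lambda>x. e (T g x)) ` {x\<in>X. e x \<le> r})"
proof -
  obtain y where "y \<in> X" "r < e y"
    using dense[of r "r + 1"] by auto
  then show ?thesis
    using assms by (intro bdd_aboveI[of _ "e (T g y)"]) (auto intro: T_mono)
qed

lemma mono_extension: "g \<in> carrier G \<Longrightarrow> mono (ext g)"
  unfolding monotone_extension_def
  by (intro monoI cSUP_subset_mono extension_nonempty extension_bdd_above) auto

text \<open>The supremum is attained at \<open>x\<close> itself, by \<open>T_mono\<close>.\<close>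

lemma extension_extends:
  assumes "g \<in> carrier G" "x \<in> X"
  shows "ext g (e x) = e (T g x)"
  unfolding monotone_extension_def using assms
  by (intro cSup_eq_maximum) (auto intro: T_mono)

lemma extension_one: "ext \<one> = id"
proof -
  have "id = ext \<one>"
    by (rule mono_eq_if_eq_on_dense_image[of _ _ X e])
      (simp_all add: mono_extension extension_extends T_one dense monoI)
  then show ?thesis ..
qed

text \<open>Each \<open>T g\<close> maps \<open>X\<close> onto itself, so the points
  \<open>e (T g x)\<close> are all of the points \<open>e x\<close> again.\<close>

lemma dense_image:
  assumes g: "g \<in> carrier G" and "a < b"
  shows "\<exists>x\<in>X. a < e (T g x) \<and> e (T g x) < b"
proof -
  obtain x where x: "x \<in> X" "a < e x" "e x < b"
    using dense[OF \<open>a < b\<close>] by blast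
  have "T g (T (inv g) x) = x"
    using T_mult[of g "inv g" x] T_one g x by simp
  then show ?thesis
    using x g T_closed[of "inv g" x] by (intro bexI[of _ "T (inv g) x"]) auto
qed

text \<open>Both sides are monotone and agree on the dense set by the action law there;
  \<open>dense_image\<close> supplies the density of values that forces equality.\<close>

lemma extension_mult:
  assumes "g \<in> carrier G" "h \<in> carrier G"
  shows "ext (g \<otimes> h) = ext g \<circ> ext h"
proof (rule mono_eq_if_eq_on_dense_image[of _ _ X e])
  show "mono (ext (g \<otimes> h))"
    using assms by (simp add: mono_extension)
  show "mono (ext g \<circ> ext h)"
    using mono_extension[OF assms(1)] mono_extension[OF assms(2)] by (simp add: mono_def)
  show "ext (g \<otimes> h) (e x) = (ext g \<circ> ext h) (e x)" if "x \<in> X" for x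
    using that assms by (simp add: extension_extends T_mult T_closed)
  show "\<exists>x\<in>X. a < ext (g \<otimes> h) (e x) \<and> ext (g \<otimes> h) (e x) < b" if "a < b" for a b
    using dense_image[OF _ that, of "g \<otimes> h"] assms by (auto simp: extension_extends)
qed

lemma extension_inverse:
  assumes "g \<in> carrier G"
  shows "ext (inv g) (ext g r) = r" "ext g (ext (inv g) r) = r"
  using assms extension_mult[of g "inv g"] extension_mult[of "inv g" g]
  by (auto simp: extension_one fun_eq_iff)

lemma extension_bij: "g \<in> carrier G \<Longrightarrow> bij (ext g)"
  by (rule bij_betw_byWitness[of _ "ext (inv g)"]) (auto simp: extension_inverse)

lemma extension_continuous:
  assumes "g \<in> carrier G"
  shows "continuous_on UNIV (ext g)"
\<comment> \<open>A monotone map can only have jumps, and a jump would leave a gap in the image;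
  surjectivity excludes this.\<close>
proof (rule continuous_onI_mono)
  show "open (range (ext g))"
    using extension_bij[OF assms] by (simp add: bij_is_surj)
  show "ext g x \<le> ext g y" if "x \<le> y" for x y
    using mono_extension[OF assms] that by (rule monoD)
qed

lemma extension_homeo:
  assumes "g \<in> carrier G"
  shows "orientation_preserving_homeo (ext g)"
  unfolding orientation_preserving_homeo_def
proof
  have "homeomorphism UNIV UNIV (ext g) (ext (inv g))"
    using assms by (intro homeomorphismI extension_continuous) (auto simp: extension_inverse)
  then show "\<exists>f'. homeomorphism UNIV UNIV (ext g) f'"
    by blast
  show "strict_mono (ext g)"
    using mono_extension[OF assms] bij_is_inj[OF extension_bij[OF assms]]
    by (simp add: strict_mono_iff_mono)
qed

lemma extension_homeo_action: "homeo_action_on_line G ext"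
  unfolding homeo_action_on_line_def
proof (intro conjI ballI extension_homeo)
  have Bij: "ext g \<in> Bij UNIV" if "g \<in> carrier G" for g
    using extension_bij[OF that] by (simp add: Bij_def)
  have "ext \<in> hom G (BijGroup UNIV)"
    by (rule homI) (auto simp: BijGroup_def Bij extension_mult compose_def)
  then show "group_action G UNIV ext"
    by (intro group_action.intro group_hom.intro group_hom_axioms.intro group_axioms group_BijGroup)
qed auto

lemma extension_almost_free:
  assumes "\<And>g. g \<in> carrier G \<Longrightarrow> (\<forall>x\<in>X. e x \<le> e (T g x)) \<or> (\<forall>x\<in>X. e (T g x) \<le> e x)"
  shows "almost_free_action G ext"
  unfolding almost_free_action_def
proof (intro conjI ballI extension_homeo_action)
  fix g assume g: "g \<in> carrier G"
  have mono: "r \<le> r' \<Longrightarrow> ext g r \<le> ext g r'" for r r'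
    using mono_extension[OF g] by (rule monoD)
  consider "\<forall>x\<in>X. e x \<le> e (T g x)" | "\<forall>x\<in>X. e (T g x) \<le> e x"
    using assms[OF g] by blast
  then show "(\<forall>r. r \<le> ext g r) \<or> (\<forall>r. ext g r \<le> r)"
  proof cases
    case 1
    have "r \<le> ext g r" for r
    proof (rule ccontr)
      assume "\<not> ?thesis"
      \<comment> \<open>Such an \<open>x\<close> gives
        \<open>e x <= e (T g x) = ext g (e x) <= ext g r < e x\<close>.\<close>
      then obtain x where x: "x \<in> X" "ext g r < e x" "e x < r"
        using dense[of "ext g r" r] by auto
      then show False
        using 1 mono[of "e x" r] extension_extends[OF g, of x] by force
    qed
    then show ?thesis by blast
  next
    case 2
    have "ext g r \<le> r" for r
    proof (rule ccontr)
      assume "\<not> ?thesis"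
      then obtain x where x: "x \<in> X" "r < e x" "e x < ext g r"
        using dense[of r "ext g r"] by auto
      then show False
        using 2 mono[of r "e x"] extension_extends[OF g, of x] by force
    qed
    then show ?thesis by blast
  qed
qed

end

section \<open>Countable linear orders with fibres \<open>(0,1)\<close> embed densely in the line\<close>

lemma countable_summable_weights:
  assumes "countable A"
  obtains w :: "'a \<Rightarrow> real" where "\<And>x. 0 < w x" "w summable_on A"
proof
  \<comment> \<open>The enumeration is injective on \<open>A\<close>, so the weights form a
    subfamily of the geometric series.\<close>
  let ?w = "\<lambda>x. (1/2) ^ to_nat_on A x :: real"
  show "0 < ?w x" for x
    by simp
  have "(\<lambda>n. (1/2) ^ n :: real) summable_on UNIV"
    by (subst summable_on_UNIV_nonneg_real_iff) (auto intro: summable_geometric)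
  then have "(\<lambda>n. (1/2) ^ n :: real) summable_on (to_nat_on A ` A)"
    by (rule summable_on_subset_banach) auto
  then show "?w summable_on A"
    using inj_on_to_nat_on[OF assms] by (simp add: summable_on_reindex o_def)
qed

text \<open>The fibres are what permits density: a discrete order such as the integers has no dense
  embedding by itself. Nonemptiness of \<open>A\<close> makes the total weight positive.\<close>

lemma countable_linear_order_dense_lex_embedding:
  assumes "countable A" and "linear_order_on A r" and "A \<noteq> {}"
  obtains e :: "'a \<Rightarrow> real \<Rightarrow> real" where
    "\<And>h s t. h \<in> A \<Longrightarrow> 0 < s \<Longrightarrow> s < t \<Longrightarrow> t < 1 \<Longrightarrow> e h s < e h t"
    "\<And>h k s t. (h, k) \<in> r \<Longrightarrow> h \<noteq> k \<Longrightarrow> 0 < s \<Longrightarrow> s < 1 \<Longrightarrow> 0 < t \<Longrightarrow> t < 1 \<Longrightarrow> e h s < e k t"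
    "\<And>a b. a < b \<Longrightarrow> \<exists>h\<in>A. \<exists>s. 0 < s \<and> s < 1 \<and> a < e h s \<and> e h s < b"
proof -
  have refl: "x \<in> A \<Longrightarrow> (x, x) \<in> r" and rA: "(x, y) \<in> r \<Longrightarrow> x \<in> A \<and> y \<in> A"
    and trans: "(x, y) \<in> r \<Longrightarrow> (y, z) \<in> r \<Longrightarrow> (x, z) \<in> r"
    and antisym: "(x, y) \<in> r \<Longrightarrow> (y, x) \<in> r \<Longrightarrow> x = y"
    for x y z
    using assms(2) unfolding order_on_defs by (auto simp: refl_on_def dest: transD antisymD)
  have total: "(x, y) \<in> r \<or> (y, x) \<in> r" if "x \<in> A" "y \<in> A" for x y
    using assms(2) that unfolding order_on_defs
    by (cases "x = y") (auto simp: refl_on_def total_on_def)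
  obtain w :: "'a \<Rightarrow> real" where w_pos: "\<And>x. 0 < w x" and "w summable_on A"
    using countable_summable_weights[OF assms(1)] by blast
  then have summable: "B \<subseteq> A \<Longrightarrow> w summable_on B" for B
    using summable_on_subset_banach by blast
  have infsum_mono: "infsum w B \<le> infsum w C" if "B \<subseteq> C" "C \<subseteq> A" for B C
    using that w_pos by (intro infsum_mono2 summable) (auto intro: less_imp_le)
  define W where "W = infsum w A"
  define below where "below h = {k \<in> A. (k, h) \<in> r \<and> k \<noteq> h}" for h
  \<comment> \<open>The interval assigned to \<open>h\<close> runs from \<open>F h\<close> to
    \<open>F h + w h\<close>.\<close>
  define F where "F h = infsum w (below h)" for h
  have below_A: "below h \<subseteq> A" for h
    by (auto simp: below_def)
  \<comment> \<open>With \<open>S = {h}\<close> this bounds the right end of the interval of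
    \<open>h\<close>; larger \<open>S\<close> serve the estimate from above in
    \<open>c_dense\<close>.\<close>
  have F_plus_sum: "F h + sum w S \<le> infsum w B"
    if "finite S" "S \<subseteq> B" "below h \<subseteq> B" "below h \<inter> S = {}" "B \<subseteq> A" for h S B
  proof -
    have "F h + sum w S = infsum w (below h \<union> S)"
      unfolding F_def using that
      by (subst infsum_Un_disjoint) (auto intro!: summable simp: below_def)
    also have "\<dots> \<le> infsum w B"
      using that by (intro infsum_mono) auto
    finally show ?thesis .
  qed
  have sum_le: "sum w S \<le> F h + w h" if "finite S" "S \<subseteq> insert h (below h)" "h \<in> A" for S h
  proof -
    have "sum w S \<le> infsum w (insert h (below h))"
      using that below_A w_pos by (intro finite_sum_le_infsum summable) (auto intro: less_imp_le)
    also have "\<dots> = infsum w (below h \<union> {h})"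
      by simp
    also have "\<dots> = F h + w h"
      unfolding F_def using that
      by (subst infsum_Un_disjoint) (auto intro!: summable simp: below_def)
    finally show ?thesis .
  qed
  have F_nonneg: "0 \<le> F h" for h
    unfolding F_def using w_pos by (intro infsum_nonneg) (auto intro: less_imp_le)
  have F_le_W: "F h + w h \<le> W" if "h \<in> A" for h
    using F_plus_sum[of "{h}" A h] that by (auto simp: W_def below_def)
  have F_less: "F h + w h \<le> F k" if "(h, k) \<in> r" "h \<noteq> k" for h k
    unfolding F_def[of k] using F_plus_sum[of "{h}" "below k" h] that
    by (auto simp: below_def dest: trans antisym rA)
  \<comment> \<open>\<open>F\<close> reflects the order because positive weights make it strictly
    increasing. Extremal elements of finite sets can thus be found by comparing real
    numbers.\<close>
  have rel_if_F_le: "(h, k) \<in> r" if "F h \<le> F k" "h \<in> A" "k \<in> A" for h k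
    using that F_less[of k h] total[of h k] refl w_pos[of k] by force
  have "W > 0"
  proof -
    obtain h where "h \<in> A"
      using assms(3) by blast
    then show ?thesis
      using F_nonneg[of h] F_le_W[of h] w_pos[of h] by linarith
  qed
  \<comment> \<open>The affine parametrisation of the interval of \<open>h\<close> by the fibre
    coordinate.\<close>
  define c where "c h s = F h + s * w h" for h s
  have c_bounds: "F h < c h s" "c h s < F h + w h" if "0 < s" "s < 1" for h s
    using that w_pos[of h] by (auto simp: c_def)
  have c_0W: "0 < c h s" "c h s < W" if "h \<in> A" "0 < s" "s < 1" for h s
    using c_bounds[OF that(2,3), of h] F_nonneg[of h] F_le_W[OF that(1)] by auto
  \<comment> \<open>If \<open>(a, b)\<close> met no interval, each would lie left of
    \<open>a\<close> or right of \<open>b\<close>. The former have total length at most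
    \<open>a\<close>, the latter at most \<open>W - b\<close>, so the total \<open>W\<close> would
    be at most \<open>W - (b - a)\<close>.\<close>
  have c_dense: "\<exists>h\<in>A. \<exists>s. 0 < s \<and> s < 1 \<and> a < c h s \<and> c h s < b"
    if ab: "0 \<le> a" "a < b" "b \<le> W" for a b
  proof (rule ccontr)
    assume contra: "\<not> ?thesis"
    have gap: "F h + w h \<le> a \<or> b \<le> F h" if "h \<in> A" for h
    proof (rule ccontr)
      assume "\<not> ?thesis"
      then have "max a (F h) < min b (F h + w h)"
        using ab w_pos[of h] by auto
      then obtain m where m: "max a (F h) < m" "m < min b (F h + w h)"
        using Rats_dense_in_real by blast
      define s where "s = (m - F h) / w h"
      have "0 < s" "s < 1" "c h s = m"
        using m w_pos[of h] by (auto simp: s_def c_def field_simps)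
      moreover have "a < m" "m < b"
        using m by auto
      ultimately show False
        using contra that by auto
    qed
    define L where "L = {h \<in> A. F h + w h \<le> a}"
    \<comment> \<open>\<open>L\<close> may lack a last element, so finite subfamilies are bounded:
      each lies at or below its greatest member \<open>h\<close>, whose interval ends by
      \<open>a\<close>. The empty sum needs \<open>0 <= a\<close>.\<close>
    have lower: "infsum w L \<le> a"
    proof (rule infsum_le_finite_sums)
      fix S assume S: "finite S" "S \<subseteq> L"
      show "sum w S \<le> a"
      proof (cases "S = {}")
        case False
        then have "Max (F ` S) \<in> F ` S"
          using S by (intro Max_in) auto
        then obtain h where "h \<in> S" "Max (F ` S) = F h"
          by blast
        with S have h: "h \<in> S" "\<And>k. k \<in> S \<Longrightarrow> F k \<le> F h"
          by (auto simp flip: \<open>Max (F ` S) = F h\<close>)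
        have "S \<subseteq> A"
          using S by (auto simp: L_def)
        then have "S \<subseteq> insert h (below h)"
          using h rel_if_F_le by (auto simp: below_def subset_iff)
        then have "sum w S \<le> F h + w h"
          using S h sum_le by (auto simp: L_def)
        also have "\<dots> \<le> a"
          using h S by (auto simp: L_def)
        finally show ?thesis .
      qed (use ab in auto)
    qed (auto intro: summable simp: L_def)
    \<comment> \<open>Symmetrically, the least member \<open>h\<close> of a finite subfamily starts
      at \<open>b\<close> or later, and everything below \<open>h\<close> is disjoint from the
      subfamily.\<close>
    have upper: "infsum w (A - L) \<le> W - b"
    proof (rule infsum_le_finite_sums)
      fix S assume S: "finite S" "S \<subseteq> A - L"
      show "sum w S \<le> W - b"
      proof (cases "S = {}")
        case False
        then have "Min (F ` S) \<in> F ` S"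
          using S by (intro Min_in) auto
        then obtain h where "h \<in> S" "Min (F ` S) = F h"
          by blast
        with S have h: "h \<in> S" "\<And>k. k \<in> S \<Longrightarrow> F h \<le> F k"
          by (auto simp flip: \<open>Min (F ` S) = F h\<close>)
        have "below h \<inter> S = {}"
          using h S rel_if_F_le antisym by (auto simp: below_def)
        then have "F h + sum w S \<le> W"
          unfolding W_def using S below_A by (intro F_plus_sum) auto
        moreover have "b \<le> F h"
          using gap[of h] h S by (auto simp: L_def)
        ultimately show ?thesis by simp
      qed (use ab in auto)
    qed (auto intro: summable)
    have "W = infsum w (L \<union> (A - L))"
      unfolding W_def by (rule arg_cong[of _ _ "infsum w"]) (auto simp: L_def)
    also have "\<dots> = infsum w L + infsum w (A - L)"
      by (rule infsum_Un_disjoint) (auto intro: summable simp: L_def)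
    finally show False
      using lower upper ab by simp
  qed
  \<comment> \<open>An increasing change of coordinates from \<open>(0, W)\<close> to the line, and
    its inverse.\<close>
  define logit where "logit y = ln (y / (W - y))" for y
  define expit where "expit z = W * exp z / (1 + exp z)" for z
  have logit_mono: "logit x < logit y" if "0 < x" "x < y" "y < W" for x y
    unfolding logit_def using that
    by (subst ln_less_cancel_iff) (auto simp: field_simps intro!: mult_strict_left_mono)
  have pos: "0 < 1 + exp z" for z :: real
    by (simp add: add_pos_pos)
  have expit_bounds: "0 < expit z" "expit z < W" for z
    using \<open>W > 0\<close> pos[of z] by (auto simp: expit_def field_simps)
  have logit_expit: "logit (expit z) = z" for z
  proof -
    have "W - expit z = W / (1 + exp z)"
      using pos[of z] by (simp add: expit_def field_simps)
    then have "expit z / (W - expit z) = exp z"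
      using pos[of z] \<open>W > 0\<close> by (simp add: expit_def)
    then show ?thesis
      by (simp add: logit_def)
  qed
  have expit_mono: "expit x < expit y" if "x < y" for x y
    using that logit_mono[of "expit y" "expit x"] expit_bounds logit_expit[of x] logit_expit[of y]
    by (cases "expit x" "expit y" rule: linorder_cases) auto
  show thesis
  proof (rule that[of "\<lambda>h s. logit (c h s)"])
    show "logit (c h s) < logit (c h t)" if "h \<in> A" "0 < s" "s < t" "t < 1" for h s t
      using that c_0W w_pos[of h] by (intro logit_mono) (auto simp: c_def)
    show "logit (c h s) < logit (c k t)"
      if "(h, k) \<in> r" "h \<noteq> k" "0 < s" "s < 1" "0 < t" "t < 1" for h k s t
      using that c_0W rA[OF that(1)] F_less[OF that(1,2)] c_bounds[of s h] c_bounds[of t k]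
      by (intro logit_mono) auto
    show "\<exists>h\<in>A. \<exists>s. 0 < s \<and> s < 1 \<and> a < logit (c h s) \<and> logit (c h s) < b"
      if ab: "a < b" for a b
    proof -
      obtain h s where hs: "h \<in> A" "0 < s" "s < 1" "expit a < c h s" "c h s < expit b"
        using c_dense[OF less_imp_le[OF expit_bounds(1)] expit_mono[OF ab]
          less_imp_le[OF expit_bounds(2)]]
        by blast
      then have "logit (expit a) < logit (c h s)" "logit (c h s) < logit (expit b)"
        using expit_bounds c_0W by (auto intro!: logit_mono)
      then show ?thesis
        using hs by (auto simp: logit_expit)
    qed
  qed
qed

section \<open>Almost free actions and bi-orders\<close>

text \<open>Faithfulness gives antisymmetry of the pointwise order. Left invariance holds since each
  homeomorphism is increasing, right invariance by evaluating the inequality at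
  \<open>\<phi> c x\<close>.\<close>

lemma bi_orderable_if_almost_free:
  assumes "faithful_action G UNIV \<phi>" and "almost_free_action G \<phi>"
  shows "bi_orderable G"
proof -
  interpret faithful_action G UNIV \<phi>
    by fact
  interpret group G
    using group_hom by (rule group_hom.axioms(1))
  have comp: "\<phi> (a \<otimes>\<^bsub>G\<^esub> b) x = \<phi> a (\<phi> b x)" if "a \<in> carrier G" "b \<in> carrier G" for a b x
    using that composition_rule by simp
  have mono: "\<phi> a x \<le> \<phi> a y" if "a \<in> carrier G" "x \<le> y" for a x y
    using assms(2) that strict_mono_mono
    by (auto simp: almost_free_action_def homeo_action_on_line_def
        orientation_preserving_homeo_def dest: monoD)
  define r where
    "r = {(a, b). a \<in> carrier G \<and> b \<in> carrier G \<and> (\<forall>x. \<phi> a x \<le> \<phi> b x)}"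
  have "antisym r"
    by (rule antisymI) (auto simp: r_def intro!: inj_onD[OF faithful] ext order_antisym)
  moreover have "(a, b) \<in> r \<or> (b, a) \<in> r" if ab: "a \<in> carrier G" "b \<in> carrier G" for a b
  proof -
    let ?c = "inv\<^bsub>G\<^esub> a \<otimes>\<^bsub>G\<^esub> b"
    have "a \<otimes>\<^bsub>G\<^esub> ?c = b"
      using ab by (simp add: m_assoc[symmetric])
    then have b: "\<phi> b x = \<phi> a (\<phi> ?c x)" for x
      using comp[of a ?c x] ab by simp
    have "(\<forall>x. x \<le> \<phi> ?c x) \<or> (\<forall>x. \<phi> ?c x \<le> x)"
      using assms(2) ab by (auto simp: almost_free_action_def)
    then show ?thesis
      using ab mono by (auto simp: r_def b)
  qed
  ultimately have "linear_order_on (carrier G) r"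
    unfolding order_on_defs
    by (auto simp: refl_on_def total_on_def r_def intro!: transI intro: order_trans)
  moreover have "left_invariant_rel G r" "right_invariant_rel G r"
    unfolding left_invariant_rel_def right_invariant_rel_def by (auto simp: r_def comp mono)
  ultimately show ?thesis
    unfolding bi_orderable_def by blast
qed

lemma almost_free_if_bi_orderable:
  fixes G :: "('a, 'b) monoid_scheme"
  assumes "group G" and "countable (carrier G)" and "bi_orderable G"
  shows "\<exists>\<phi>. faithful_action G UNIV \<phi> \<and> almost_free_action G \<phi>"
proof -
  interpret group G
    by fact
  obtain r where r: "linear_order_on (carrier G) r" "left_invariant_rel G r"
    "right_invariant_rel G r"
    using assms(3) by (auto simp: bi_orderable_def)
  have total: "(x, y) \<in> r \<or> (y, x) \<in> r" if "x \<in> carrier G" "y \<in> carrier G" for x y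
    using r(1) that unfolding order_on_defs
    by (cases "x = y") (auto simp: refl_on_def total_on_def)
  have "carrier G \<noteq> {}"
    using one_closed by blast
  then obtain e :: "'a \<Rightarrow> real \<Rightarrow> real" where
    fib: "\<And>h s t. h \<in> carrier G \<Longrightarrow> 0 < s \<Longrightarrow> s < t \<Longrightarrow> t < 1 \<Longrightarrow> e h s < e h t" and
    lex: "\<And>h k s t. (h, k) \<in> r \<Longrightarrow> h \<noteq> k \<Longrightarrow>
      0 < s \<Longrightarrow> s < 1 \<Longrightarrow> 0 < t \<Longrightarrow> t < 1 \<Longrightarrow> e h s < e k t" and
    dense: "\<And>a b. a < b \<Longrightarrow> \<exists>h\<in>carrier G. \<exists>s. 0 < s \<and> s < 1 \<and> a < e h s \<and> e h s < b"
    by (rule countable_linear_order_dense_lex_embedding[OF assms(2) r(1)]) (rule that)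
  define X where "X = carrier G \<times> {0<..<1::real}"
  define T where "T g = (\<lambda>(h, s). (g \<otimes>\<^bsub>G\<^esub> h, s :: real))" for g
  \<comment> \<open>Within one fibre only the unchanged second coordinates matter; across fibres
    left invariance and cancellation preserve the strict order.\<close>
  have T_mono: "case_prod e (T g x) \<le> case_prod e (T g y)"
    if g: "g \<in> carrier G" and xy: "x \<in> X" "y \<in> X" "case_prod e x \<le> case_prod e y" for g x y
  proof -
    obtain h s k t where hk: "x = (h, s)" "y = (k, t)"
      by fastforce
    then have X: "h \<in> carrier G" "k \<in> carrier G" "0 < s" "s < 1" "0 < t" "t < 1"
      and le: "e h s \<le> e k t"
      using xy by (auto simp: X_def)
    show ?thesis
    proof (cases "h = k")
      case True
      then have "s \<le> t"
        using fib[of h t s] X le by force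
      then show ?thesis
        using fib[of "g \<otimes>\<^bsub>G\<^esub> h" s t] X g True by (cases "s = t") (auto simp: T_def hk)
    next
      case False
      then have "(h, k) \<in> r"
        using total[of h k] lex[of k h t s] X le by force
      then have "(g \<otimes>\<^bsub>G\<^esub> h, g \<otimes>\<^bsub>G\<^esub> k) \<in> r" "g \<otimes>\<^bsub>G\<^esub> h \<noteq> g \<otimes>\<^bsub>G\<^esub> k"
        using r(2) g X False by (auto simp: left_invariant_rel_def)
      from lex[OF this] show ?thesis
        using X by (force simp: T_def hk)
    qed
  qed
  interpret dense_action G X "case_prod e" T
  proof unfold_locales
    show "\<exists>x\<in>X. a < case_prod e x \<and> case_prod e x < b" if "a < b" for a b
      using dense[OF that] by (force simp: X_def)
  qed (auto simp: T_mono, auto simp: X_def T_def m_assoc)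
  have "almost_free_action G ext"
  proof (rule extension_almost_free)
    fix g assume g: "g \<in> carrier G"
    show "(\<forall>x\<in>X. case_prod e x \<le> case_prod e (T g x)) \<or>
      (\<forall>x\<in>X. case_prod e (T g x) \<le> case_prod e x)"
    \<comment> \<open>The identity is separated because \<open>lex\<close> compares distinct group
      elements only.\<close>
    proof (cases "g = \<one>\<^bsub>G\<^esub>")
      case True
      then show ?thesis by (auto simp: T_one)
    next
      case False
      then have ne: "g \<otimes>\<^bsub>G\<^esub> h \<noteq> h" if "h \<in> carrier G" for h
        using that g by (metis r_cancel_one)
      have right: "(a \<otimes>\<^bsub>G\<^esub> h, b \<otimes>\<^bsub>G\<^esub> h) \<in> r"
        if "(a, b) \<in> r" "a \<in> carrier G" "b \<in> carrier G" "h \<in> carrier G" for a b h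
        using r(3) that by (auto simp: right_invariant_rel_def)
      \<comment> \<open>Multiplying the comparison of the identity with \<open>g\<close> by
        \<open>h\<close> on the right yields the same direction for every \<open>h\<close>.\<close>
      have "(\<forall>h\<in>carrier G. (h, g \<otimes>\<^bsub>G\<^esub> h) \<in> r) \<or> (\<forall>h\<in>carrier G. (g \<otimes>\<^bsub>G\<^esub> h, h) \<in> r)"
        using total[of "\<one>\<^bsub>G\<^esub>" g] right[of "\<one>\<^bsub>G\<^esub>" g] right[of g "\<one>\<^bsub>G\<^esub>"] g by auto
      then show ?thesis
      proof
        assume "\<forall>h\<in>carrier G. (h, g \<otimes>\<^bsub>G\<^esub> h) \<in> r"
        then have "\<forall>x\<in>X. case_prod e x \<le> case_prod e (T g x)"
          using ne[symmetric] by (auto simp: X_def T_def intro!: less_imp_le[OF lex])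
        then show ?thesis ..
      next
        assume "\<forall>h\<in>carrier G. (g \<otimes>\<^bsub>G\<^esub> h, h) \<in> r"
        then have "\<forall>x\<in>X. case_prod e (T g x) \<le> case_prod e x"
          using ne by (auto simp: X_def T_def intro!: less_imp_le[OF lex])
        then show ?thesis ..
      qed
    qed
  qed
  moreover have "inj_on ext (carrier G)"
  proof (rule inj_onI)
    fix g h assume gh: "g \<in> carrier G" "h \<in> carrier G" and eq: "ext g = ext h"
    \<comment> \<open>One test point suffices: its image under \<open>T g\<close> lies in the fibre
      over \<open>g\<close>, and distinct fibres have disjoint images.\<close>
    have "(\<one>\<^bsub>G\<^esub>, 1/2) \<in> X"
      by (simp add: X_def)
    from extension_extends[OF gh(1) this] extension_extends[OF gh(2) this] eq gh
    have "e g (1/2) = e h (1/2)"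
      by (simp add: T_def)
    then show "g = h"
      using total[OF gh] lex[of g h "1/2" "1/2"] lex[of h g "1/2" "1/2"] by force
  qed
  ultimately show ?thesis
    by (auto simp: almost_free_action_def homeo_action_on_line_def
        intro!: exI[of _ ext] faithful_action.intro faithful_action_axioms.intro)
qed

theorem proposition3p4:
  fixes G :: "('a, 'b) monoid_scheme"
  assumes "group G" and "countable (carrier G)"
  shows "(\<exists>\<phi>. faithful_action G UNIV \<phi> \<and> almost_free_action G \<phi>) \<longleftrightarrow> bi_orderable G"
  using bi_orderable_if_almost_free almost_free_if_bi_orderable[OF assms] by blast

end
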